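(* Let $(X,d)$ be a complete metric space and let $T:X\to P(X)$ be an operator such that $SFix(T)\neq\emptyset$. Suppose there exist $\alpha,\beta,\gamma\ge 0$ with $\alpha+\beta+\gamma<1$ such that $$H(T(x),T(y))\le \alpha\, d(x,y)+\beta\, D(x,T(y))+\gamma\, D(y,T(x))\quad\text{for all } x,y\in X.$$ Then the strict fixed point problem $T(x)=\{x\}$ has the Ostrowski stability property.
   Context: For a metric space $(X,d)$, $P(X)$ is the family of all nonempty subsets of $X$. For $T:X\to P(X)$, $SFix(T)=\{x\in X: T(x)=\{x\}\}$. For $A,B\in P(X)$: $D(A,B)=\inf\{d(a,b):a\in A,b\in B\}$, with $D(x,B):=D(\{x\},B)$; $e(A,B)=\sup\{D(a,B):a\in A\}\in[0,+\infty]$; $H(A,B)=\max\{e(A,B),e(B,A)\}\in[0,+\infty]$. The strict fixed point problem $T(x)=\{x\}$ has the Ostrowski stability property if $SFix(T)=\{x^*\}$ for some $x^*\in X$ and, for every sequence $(v_n)_{n\in\mathbb{N}}\subset X$, $D(v_{n+1},T(v_n))\to 0$ implies $v_n\to x^*$ as $n\to\infty$. *)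

theory Defs
  imports "HOL-Analysis.Analysis"
begin

text \<open>
  The gap \<open>D(A,B)\<close> is the library's \<open>setdist\<close>, and \<open>D(x,B)\<close> is \<open>setdist {x} B\<close>. The library
  sets \<open>setdist A B = 0\<close> when \<open>A\<close> or \<open>B\<close> is empty, so the notions below are meant for nonempty
  sets only; \<open>T : X \<rightarrow> P(X)\<close> is a function \<open>T :: 'a \<Rightarrow> 'a set\<close> with \<open>T x \<noteq> {}\<close> for all \<open>x\<close>.
  Excess and Hausdorff distance take values in \<open>[0,\<infinity>]\<close>, hence the type \<open>ennreal\<close>.
\<close>

definition excess :: "'a::metric_space set \<Rightarrow> 'a set \<Rightarrow> ennreal" where
  "excess A B = (SUP a\<in>A. ennreal (setdist {a} B))"

definition hausdorff :: "'a::metric_space set \<Rightarrow> 'a set \<Rightarrow> ennreal" where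
  "hausdorff A B = max (excess A B) (excess B A)"

definition SFix :: "('a \<Rightarrow> 'a set) \<Rightarrow> 'a set" where
  "SFix T = {x. T x = {x}}"

definition ostrowski_stable :: "('a::metric_space \<Rightarrow> 'a set) \<Rightarrow> bool" where
  "ostrowski_stable T \<longleftrightarrow>
     (\<exists>x. SFix T = {x} \<and>
       (\<forall>v :: nat \<Rightarrow> 'a.
          (\<lambda>n. setdist {v (Suc n)} (T (v n))) \<longlonglongrightarrow> 0 \<longrightarrow> v \<longlonglongrightarrow> x))"

end

theory Submission
  imports Defs
begin

text \<open>
  Compare an arbitrary point \<open>x\<close> with a strict fixed point \<open>p\<close>. Since \<open>T p = {p}\<close>, the distance
  \<open>D(x, T p)\<close> is just \<open>dist x p\<close>, and the Hausdorff distance of \<open>T x\<close> and \<open>{p}\<close> dominates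
  \<open>dist u p\<close> for every \<open>u \<in> T x\<close>. The remaining term \<open>D(p, T x)\<close> is at most \<open>dist u p\<close> for that
  very \<open>u\<close>, so it can be absorbed on the left: every \<open>u \<in> T x\<close> satisfies
  \<open>dist u p \<le> k * dist x p\<close> with \<open>k = (\<alpha> + \<beta>) / (1 - \<gamma>) < 1\<close>. This is
  \<open>quasi_contraction_at_strict_fixpoint\<close>: \<open>T\<close> pulls all of \<open>T x\<close> towards \<open>p\<close> by a uniform factor.

  A second strict fixed point \<open>q\<close> would give \<open>dist q p \<le> k * dist q p\<close>, so \<open>p\<close> is the only one.
  For a sequence \<open>v\<close>, the triangle inequality through nearly nearest points of \<open>T (v n)\<close> gives
  \<open>dist (v (n+1)) p \<le> k * dist (v n) p + D(v (n+1), T (v n))\<close>, and a nonnegative sequence with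
  such a recursion and vanishing perturbation tends to 0
  (\<open>perturbed_contraction_tendsto_zero\<close>).
\<close>

text \<open>
  Once the perturbation stays below \<open>(1 - k) * d\<close>, the sequence is dominated by iterates of
  \<open>t \<mapsto> k * t + (1 - k) * d\<close>, whose fixed point is \<open>d\<close> and which shrinks the distance to \<open>d\<close>
  by the factor \<open>k\<close>. As \<open>d > 0\<close> is arbitrary, the limit is 0.
\<close>
lemma perturbed_contraction_tendsto_zero:
  fixes a b :: "nat \<Rightarrow> real"
  assumes nonneg: "\<And>n. 0 \<le> a n"
    and k: "0 \<le> k" "k < 1"
    and step: "\<And>n. a (Suc n) \<le> k * a n + b n"
    and b: "b \<longlonglongrightarrow> 0"
  shows "a \<longlonglongrightarrow> 0"
proof (rule order_tendstoI)
  fix c :: real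
  assume "c < 0"
  then show "\<forall>\<^sub>F n in sequentially. c < a n"
    using nonneg by (intro always_eventually allI) (rule less_le_trans)
next
  fix c :: real
  assume c: "0 < c"
  define d where "d = c / 2"
  have "\<forall>\<^sub>F n in sequentially. b n < (1 - k) * d"
    using b k c by (intro order_tendstoD(2)[OF b]) (simp add: d_def)
  then obtain N where N: "\<And>n. N \<le> n \<Longrightarrow> b n < (1 - k) * d"
    unfolding eventually_sequentially by blast
  have bound: "a (m + N) \<le> k ^ m * a N + d" for m
  proof (induction m)
    case 0
    then show ?case using c by (simp add: d_def)
  next
    case (Suc m)
    have "a (Suc m + N) \<le> k * a (m + N) + b (m + N)"
      using step by simp
    also have "\<dots> \<le> k * (k ^ m * a N + d) + (1 - k) * d"
      using N[of "m + N"] by (intro add_mono mult_left_mono Suc k) simp_all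
    finally show ?case by (simp add: algebra_simps)
  qed
  have "(\<lambda>m. k ^ m * a N + d) \<longlonglongrightarrow> 0 * a N + d"
    using k by (intro tendsto_intros LIMSEQ_realpow_zero)
  then have "\<forall>\<^sub>F m in sequentially. k ^ m * a N + d < c"
    by (rule order_tendstoD(2)) (use c in \<open>simp add: d_def\<close>)
  then have "\<forall>\<^sub>F m in sequentially. a (m + N) < c"
    by eventually_elim (use bound le_less_trans in blast)
  then show "\<forall>\<^sub>F n in sequentially. a n < c"
    by (rule eventually_sequentially_seg[THEN iffD1])
qed

lemma setdist_le_of_hausdorff_le:
  assumes "hausdorff A B \<le> ennreal r" and "0 \<le> r" and "a \<in> A"
  shows "setdist {a} B \<le> r"
proof -
  have "ennreal (setdist {a} B) \<le> excess A B"
    unfolding excess_def using assms(3) by (rule SUP_upper)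
  also have "\<dots> \<le> ennreal r"
    using assms(1) unfolding hausdorff_def by simp
  finally show ?thesis using assms(2) by (simp add: ennreal_le_iff)
qed

text \<open>
  The Hausdorff distance bounds \<open>dist u p\<close> by two terms proportional to \<open>dist x p\<close> and the
  term \<open>\<gamma> * setdist {p} (T x)\<close>, which is at most \<open>\<gamma> * dist u p\<close> because \<open>u\<close> competes in
  that infimum; moving it to the left leaves the factor \<open>1 - \<gamma>\<close>.
\<close>
lemma quasi_contraction_at_strict_fixpoint:
  fixes T :: "'a::metric_space \<Rightarrow> 'a set"
  assumes coeffs: "\<alpha> \<ge> 0" "\<beta> \<ge> 0" "\<gamma> \<ge> 0" "\<gamma> < 1"
    and contr: "hausdorff (T x) (T p)
           \<le> ennreal (\<alpha> * dist x p + \<beta> * setdist {x} (T p) + \<gamma> * setdist {p} (T x))"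
    and p: "T p = {p}" and u: "u \<in> T x"
  shows "dist u p \<le> (\<alpha> + \<beta>) / (1 - \<gamma>) * dist x p"
proof -
  have "setdist {u} (T p) \<le> \<alpha> * dist x p + \<beta> * setdist {x} (T p) + \<gamma> * setdist {p} (T x)"
    using contr _ u by (rule setdist_le_of_hausdorff_le) (use coeffs in \<open>simp add: setdist_pos_le\<close>)
  then have "dist u p \<le> (\<alpha> + \<beta>) * dist x p + \<gamma> * setdist {p} (T x)"
    by (simp add: p algebra_simps)
  also have "\<dots> \<le> (\<alpha> + \<beta>) * dist x p + \<gamma> * dist u p"
    using setdist_le_dist[of p "{p}" u "T x"] u coeffs
    by (intro add_left_mono mult_left_mono) (simp_all add: dist_commute)
  finally have "(1 - \<gamma>) * dist u p \<le> (\<alpha> + \<beta>) * dist x p"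
    by (simp add: algebra_simps)
  then show ?thesis
    using coeffs by (simp add: field_simps)
qed

text \<open>
  A triangle inequality for the gap: the infimum defining \<open>setdist {w} A\<close> need not be attained,
  so the bound is obtained by passing to the infimum over all \<open>u \<in> A\<close>.
\<close>
lemma dist_le_setdist_add_radius:
  assumes "A \<noteq> {}" and "\<And>u. u \<in> A \<Longrightarrow> dist u p \<le> r"
  shows "dist w p \<le> setdist {w} A + r"
proof -
  have "dist w p - r \<le> dist w u" if "u \<in> A" for u
    using dist_triangle[of w p u] assms(2)[OF that] by linarith
  then have "dist w p - r \<le> setdist {w} A"
    using assms(1) by (intro le_setdistI) auto
  then show ?thesis by linarith
qed

theorem theorem2p6:
  fixes T :: "'a::complete_space \<Rightarrow> 'a set"
    and \<alpha> \<beta> \<gamma> :: real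
  assumes "\<And>x. T x \<noteq> {}"
    and "SFix T \<noteq> {}"
    and "\<alpha> \<ge> 0" and "\<beta> \<ge> 0" and "\<gamma> \<ge> 0"
    and "\<alpha> + \<beta> + \<gamma> < 1"
    and "\<And>x y. hausdorff (T x) (T y)
           \<le> ennreal (\<alpha> * dist x y + \<beta> * setdist {x} (T y) + \<gamma> * setdist {y} (T x))"
  shows "ostrowski_stable T"
proof -
  obtain p where p: "T p = {p}"
    using assms(2) unfolding SFix_def by blast
  define k where "k = (\<alpha> + \<beta>) / (1 - \<gamma>)"
  have k: "0 \<le> k" "k < 1"
    using assms(3-6) by (simp_all add: k_def)
  have quasi: "dist u p \<le> k * dist x p" if "u \<in> T x" for u x
    unfolding k_def
    by (rule quasi_contraction_at_strict_fixpoint[where T = T])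
      (use assms(3-6) assms(7)[of x p] p that in auto)
  have unique: "q = p" if "T q = {q}" for q
  proof (rule ccontr)
    assume "q \<noteq> p"
    then have "k * dist q p < 1 * dist q p"
      using k by (intro mult_strict_right_mono) simp_all
    then show False
      using quasi[of q q] that by simp
  qed
  have "v \<longlonglongrightarrow> p" if v: "(\<lambda>n. setdist {v (Suc n)} (T (v n))) \<longlonglongrightarrow> 0" for v
  proof -
    have "dist (v (Suc n)) p \<le> k * dist (v n) p + setdist {v (Suc n)} (T (v n))" for n
    proof -
      have "dist (v (Suc n)) p \<le> setdist {v (Suc n)} (T (v n)) + k * dist (v n) p"
        by (intro dist_le_setdist_add_radius assms(1) quasi)
      then show ?thesis by linarith
    qed
    then have "(\<lambda>n. dist (v n) p) \<longlonglongrightarrow> 0"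
      by (rule perturbed_contraction_tendsto_zero[OF zero_le_dist k _ v])
    then show ?thesis
      by (rule tendsto_dist_iff[THEN iffD2])
  qed
  moreover have "SFix T = {p}"
    using p unique unfolding SFix_def by blast
  ultimately show ?thesis
    unfolding ostrowski_stable_def by blast
qed

end
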